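(* Let $\alpha>3/2$. There exist an absolute constant $C$ and an integer $n_0$ depending only on $\alpha$ such that for all integers $n\ge n_0$ and $d\ge 2$, $$\Big|\mathbb P\{d\mid S_n\}-\frac1d-\frac1d\sum_{1\le j\le \frac{d}{\pi}(\log n)\left(\frac{\alpha}{2n}\right)^{1/2}} e^{2i\pi m_n\frac{j}{d}-2\pi^2B_n\left(\frac{j}{d}\right)^2}\Big|\le C\,\frac{d^3\alpha^3(\log n)^4}{n^{3/2}}.$$
   Context: Cramér random walk: $\xi_i$, $i\ge 3$, are independent random variables with $\mathbb P\{\xi_i=1\}=1-\mathbb P\{\xi_i=0\}=\frac{1}{\log i}$, and $S_n=\sum_{i=3}^n\xi_i$. Put $m_n=\mathbb E S_n=\sum_{j=3}^n\frac{1}{\log j}$ and $B_n=\operatorname{Var}S_n=\sum_{j=3}^n\frac1{\log j}\big(1-\frac1{\log j}\big)$. An empty sum equals $0$; every $d$ divides $0$. *)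

theory Defs
  imports "HOL-Probability.Probability"
begin

text \<open>The steps take values in \<^typ>\<open>nat\<close>, so that divisibility of the partial sums makes sense.
  They are only almost surely 0 or 1, as usual for conditions on the law.\<close>

locale cramer_model = prob_space M for M :: "'a measure" +
  fixes \<xi> :: "nat \<Rightarrow> 'a \<Rightarrow> nat"
  assumes indep_steps: "indep_vars (\<lambda>_. count_space UNIV) \<xi> {3..}"
    and prob_step_1: "\<And>i. i \<ge> 3 \<Longrightarrow> prob {\<omega> \<in> space M. \<xi> i \<omega> = 1} = 1 / ln (real i)"
    and prob_step_0: "\<And>i. i \<ge> 3 \<Longrightarrow> prob {\<omega> \<in> space M. \<xi> i \<omega> = 0} = 1 - 1 / ln (real i)"

definition walk :: "(nat \<Rightarrow> 'a \<Rightarrow> nat) \<Rightarrow> nat \<Rightarrow> 'a \<Rightarrow> nat" where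
  "walk \<xi> n \<omega> = (\<Sum>i=3..n. \<xi> i \<omega>)"

definition walk_mean :: "'a measure \<Rightarrow> (nat \<Rightarrow> 'a \<Rightarrow> nat) \<Rightarrow> nat \<Rightarrow> real" where
  "walk_mean M \<xi> n = prob_space.expectation M (\<lambda>\<omega>. real (walk \<xi> n \<omega>))"

definition walk_var :: "'a measure \<Rightarrow> (nat \<Rightarrow> 'a \<Rightarrow> nat) \<Rightarrow> nat \<Rightarrow> real" where
  "walk_var M \<xi> n = prob_space.variance M (\<lambda>\<omega>. real (walk \<xi> n \<omega>))"

end

theory Submission
  imports Defs "HOL-Real_Asymp.Real_Asymp"
begin

text \<open>
  Put \<open>t = ln n * sqrt (\<alpha> / (2 * n))\<close>, so that the sum runs over \<open>j \<le> d * t / pi\<close>. If it is nonempty,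
  then \<open>d \<ge> pi / t\<close> makes \<open>d ^ 3 * \<alpha> ^ 3 * ln n ^ 4 / n powr (3 / 2)\<close> at least 1 for large \<open>n\<close>,
  while the left-hand side is at most 2. If it is empty, then \<open>t < pi / d\<close>, and Fourier inversion
  on the cyclic group of order \<open>d\<close> leaves the characteristic function at the frequencies
  \<open>2 * pi * j / d\<close>, \<open>1 \<le> j < d\<close>. There it is at most \<open>exp (- 2 * V * sin t ^ 2)\<close> with \<open>V\<close>
  the variance, and \<open>2 * V * sin t ^ 2\<close> is asymptotic to \<open>\<alpha> * ln n\<close>, so \<open>\<alpha> > 3 / 2\<close> bounds it by
  \<open>n powr - (3 / 2)\<close>.
\<close>

section \<open>Roots of unity and elementary estimates\<close>

text \<open>The summands are the powers of one \<open>d\<close>-th root of unity \<open>z\<close>,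
  so their geometric sum vanishes unless \<open>z = 1\<close>, that is, unless
  \<open>d dvd k\<close>.\<close>

lemma roots_of_unity_filter:
  fixes d k :: nat
  assumes "d > 0"
  shows "(\<Sum>j<d. iexp (2 * pi * real j / real d * real k)) = (if d dvd k then of_nat d else 0)"
proof -
  define z where "z = exp (2 * of_real pi * \<i> * of_nat k / of_nat d)"
  have z1: "z = 1 \<longleftrightarrow> d dvd k"
    unfolding z_def using complex_root_unity_eq_1[of d k] assms by simp
  have pow: "iexp (2 * pi * real j / real d * real k) = z ^ j" for j
    unfolding z_def exp_of_nat_mult[symmetric] by (simp add: field_simps)
  have zd: "z ^ d = 1"
    unfolding z_def using complex_root_unity[of d k] assms by simp
  show ?thesis
    unfolding pow using z1 zd by (auto simp: sum_gp_strict)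
qed

text \<open>The squared modulus is exactly \<open>1 - 4 * p * (1 - p) * sin (t / 2) ^ 2\<close>, and
  \<open>1 + x\<close> is at most \<open>exp x\<close>.\<close>

lemma cmod_bernoulli_char_le:
  fixes p t :: real
  assumes "0 \<le> p" "p \<le> 1"
  shows "cmod (of_real (1 - p) + of_real p * iexp t) \<le> exp (- 2 * p * (1 - p) * sin (t / 2) ^ 2)"
proof (rule power2_le_imp_le)
  have s: "sin t ^ 2 = 1 - cos t ^ 2"
    by (simp add: sin_squared_eq)
  have c: "cos t = 1 - 2 * sin (t / 2) ^ 2"
    using cos_double_sin[of "t / 2"] by simp
  have "cmod (of_real (1 - p) + of_real p * iexp t) ^ 2 = (1 - p + p * cos t) ^ 2 + (p * sin t) ^ 2"
    by (simp add: cmod_power2 Re_exp Im_exp)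
  also have "\<dots> = 1 + - 4 * p * (1 - p) * sin (t / 2) ^ 2"
    unfolding power_mult_distrib s c by (simp add: algebra_simps power2_eq_square)
  also have "\<dots> \<le> exp (- 4 * p * (1 - p) * sin (t / 2) ^ 2)"
    by (rule exp_ge_add_one_self)
  also have "\<dots> = exp (- 2 * p * (1 - p) * sin (t / 2) ^ 2) ^ 2"
    by (simp add: exp_double[symmetric] algebra_simps)
  finally show "cmod (of_real (1 - p) + of_real p * iexp t) ^ 2 \<le> \<dots>" .
qed simp

text \<open>Sine increases on \<open>[0, pi / 2]\<close> and is symmetric about
  \<open>pi / 2\<close>. It will be applied to the half-angles
  \<open>x = pi * j / d\<close>.\<close>

lemma sin_le_sin_of_symmetric_interval:
  fixes t x :: real
  assumes "0 \<le> t" "t \<le> x" "x \<le> pi - t"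
  shows "sin t \<le> sin x"
proof (cases "x \<le> pi / 2")
  case True
  then show ?thesis using assms by (intro sin_monotone_2pi_le) auto
next
  case False
  have "sin t \<le> sin (pi - x)"
    using assms False by (intro sin_monotone_2pi_le) auto
  then show ?thesis by simp
qed

text \<open>The map \<open>p * (1 - p)\<close> increases on \<open>[0, 1 / 2]\<close>, and
  \<open>1 / ln i\<close> decreases and is below \<open>1 / 2\<close> from \<open>i = 8\<close> on,
  because \<open>exp 2 < 8\<close>. So each of the \<open>n - 7\<close> terms from 8 to
  \<open>n\<close> is at least the last one; the terms from 3 to 7 are nonnegative and are
  dropped.\<close>

lemma sum_bernoulli_variances_ge:
  fixes n :: nat
  assumes "n \<ge> 8"
  shows "(real n - 7) * (1 / ln (real n) * (1 - 1 / ln (real n)))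
         \<le> (\<Sum>i=3..n. 1 / ln (real i) * (1 - 1 / ln (real i)))"
proof -
  let ?v = "\<lambda>i::nat. 1 / ln (real i) * (1 - 1 / ln (real i))"
  have e1: "exp (1::real) < 3" using e_less_272 by simp
  have ln3: "ln (real i) > 1" if "i \<ge> 3" for i
    using e1 that ln_less_cancel_iff[of "exp 1" "real i"] by simp
  have "exp (2::real) = exp 1 ^ 2" by (simp add: exp_double[symmetric])
  also have "\<dots> \<le> 2.72 ^ 2" using e_less_272 by (intro power_mono) auto
  also have "\<dots> < (8::real)" by (simp add: power2_eq_square)
  finally have e2: "exp (2::real) < 8" .
  have mono: "?v n \<le> ?v i" if "i \<in> {8..n}" for i
  proof -
    define a b where "a = 1 / ln (real n)" and "b = 1 / ln (real i)"
    have "ln (real i) > 2"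
      using e2 that ln_less_cancel_iff[of "exp 2" "real i"] by simp
    moreover have "ln (real i) \<le> ln (real n)" using that by simp
    ultimately have "a \<le> b" "b \<le> 1 / 2"
      unfolding a_def b_def by (auto simp: field_simps)
    \<comment> \<open>This product is the difference
      \<open>b * (1 - b) - a * (1 - a)\<close>.\<close>
    then have "0 \<le> (b - a) * (1 - a - b)" by (intro mult_nonneg_nonneg) auto
    then show ?thesis unfolding a_def[symmetric] b_def[symmetric] by (simp add: algebra_simps)
  qed
  have "(real n - 7) * ?v n = (\<Sum>i=8..n. ?v n)"
    using assms by simp
  also have "\<dots> \<le> (\<Sum>i=8..n. ?v i)" by (intro sum_mono mono)
  also have "\<dots> \<le> (\<Sum>i=3..n. ?v i)"
  proof (rule sum_mono2)
    fix b assume "b \<in> {3..n} - {8..n}"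
    then show "0 \<le> ?v b" using ln3[of b] by (intro mult_nonneg_nonneg) auto
  qed auto
  finally show ?thesis .
qed

section \<open>Characteristic function of the walk and Fourier inversion\<close>

context cramer_model
begin

lemma step_measurable: "i \<ge> 3 \<Longrightarrow> \<xi> i \<in> M \<rightarrow>\<^sub>M count_space UNIV"
  using indep_steps by (auto simp: indep_vars_def)

lemma walk_measurable: "walk \<xi> n \<in> M \<rightarrow>\<^sub>M count_space UNIV"
proof -
  have "walk \<xi> n \<in> borel_measurable M"
    unfolding walk_def[abs_def]
    by (intro borel_measurable_sum measurable_compose[OF step_measurable]) auto
  then show ?thesis
    using measurable_cong_sets[OF refl sets_borel_eq_count_space] by blast
qed

text \<open>The two events are disjoint and their probabilities add up to 1.\<close>

lemma AE_step: assumes "i \<ge> 3" shows "AE \<omega> in M. \<xi> i \<omega> = 0 \<or> \<xi> i \<omega> = 1"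
proof -
  note [measurable] = step_measurable[OF assms]
  have "prob ({\<omega> \<in> space M. \<xi> i \<omega> = 0} \<union> {\<omega> \<in> space M. \<xi> i \<omega> = 1}) = 1"
    using prob_step_0[OF assms] prob_step_1[OF assms]
    by (subst finite_measure_Union) auto
  then have "prob {\<omega> \<in> space M. \<xi> i \<omega> = 0 \<or> \<xi> i \<omega> = 1} = 1"
    by (simp add: Collect_disj_eq[symmetric] conj_disj_distribL[symmetric] Un_def)
  then show ?thesis
    by (subst (asm) prob_Collect_eq_1) auto
qed

lemma char_step:
  assumes "i \<ge> 3"
  shows "char (distr M borel (\<lambda>\<omega>. real (\<xi> i \<omega>))) t =
         of_real (1 - 1 / ln (real i)) + of_real (1 / ln (real i)) * iexp t"
proof -
  note [measurable] = step_measurable[OF assms]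
  have "char (distr M borel (\<lambda>\<omega>. real (\<xi> i \<omega>))) t = expectation (\<lambda>\<omega>. iexp (t * real (\<xi> i \<omega>)))"
    unfolding char_def by (subst integral_distr) auto
  also have "\<dots> = expectation (\<lambda>\<omega>. of_real (indicator {\<omega> \<in> space M. \<xi> i \<omega> = 0} \<omega>)
                      + of_real (indicator {\<omega> \<in> space M. \<xi> i \<omega> = 1} \<omega>) * iexp t)"
  proof (rule integral_cong_AE)
    show "AE \<omega> in M. iexp (t * real (\<xi> i \<omega>)) = of_real (indicator {\<omega> \<in> space M. \<xi> i \<omega> = 0} \<omega>)
                      + of_real (indicator {\<omega> \<in> space M. \<xi> i \<omega> = 1} \<omega>) * iexp t"
      using AE_step[OF assms] AE_space by eventually_elim auto
  qed auto
  also have "\<dots> = of_real (prob {\<omega> \<in> space M. \<xi> i \<omega> = 0}) + of_real (prob {\<omega> \<in> space M. \<xi> i \<omega> = 1}) * iexp t"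
    by (subst Bochner_Integration.integral_add) (auto simp: less_top[symmetric])
  finally show ?thesis using prob_step_0[OF assms] prob_step_1[OF assms] by simp
qed

text \<open>Independence turns the characteristic function of the sum into a product over the
  steps.\<close>

lemma char_walk:
  "expectation (\<lambda>\<omega>. iexp (t * real (walk \<xi> n \<omega>))) =
   (\<Prod>i=3..n. of_real (1 - 1 / ln (real i)) + of_real (1 / ln (real i)) * iexp t)"
proof -
  have "indep_vars (\<lambda>_. borel) (\<lambda>i \<omega>. real (\<xi> i \<omega>)) {3..n}"
    by (rule indep_vars_compose2[OF indep_vars_subset[OF indep_steps]]) auto
  from char_distr_sum[OF this, of t]
  have "char (distr M borel (\<lambda>\<omega>. real (walk \<xi> n \<omega>))) t = (\<Prod>i=3..n. char (distr M borel (\<lambda>\<omega>. real (\<xi> i \<omega>))) t)"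
    by (simp add: walk_def)
  moreover have "char (distr M borel (\<lambda>\<omega>. real (walk \<xi> n \<omega>))) t = expectation (\<lambda>\<omega>. iexp (t * real (walk \<xi> n \<omega>)))"
    using walk_measurable[of n] unfolding char_def by (subst integral_distr) auto
  ultimately show ?thesis by (simp add: char_step)
qed

lemma cmod_char_walk_le:
  "cmod (expectation (\<lambda>\<omega>. iexp (t * real (walk \<xi> n \<omega>))))
   \<le> exp (- 2 * (\<Sum>i=3..n. 1 / ln (real i) * (1 - 1 / ln (real i))) * sin (t / 2) ^ 2)"
proof -
  have "cmod (expectation (\<lambda>\<omega>. iexp (t * real (walk \<xi> n \<omega>))))
     \<le> (\<Prod>i=3..n. exp (- 2 * (1 / ln (real i)) * (1 - 1 / ln (real i)) * sin (t / 2) ^ 2))"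
    unfolding char_walk prod_norm[symmetric]
  proof (rule prod_mono, intro conjI cmod_bernoulli_char_le)
    fix i assume "i \<in> {3..n}"
    then have i: "i \<ge> 3" by simp
    \<comment> \<open>Both bounds hold because \<open>1 / ln i\<close> is a probability in the
      model.\<close>
    show "0 \<le> 1 / ln (real i)" using measure_nonneg prob_step_1[OF i] by metis
    show "1 / ln (real i) \<le> 1" using prob_le_1 prob_step_1[OF i] by metis
  qed simp
  also have "\<dots> = exp (\<Sum>i=3..n. - 2 * (1 / ln (real i)) * (1 - 1 / ln (real i)) * sin (t / 2) ^ 2)"
    by (simp add: exp_sum)
  also have "(\<Sum>i=3..n. - 2 * (1 / ln (real i)) * (1 - 1 / ln (real i)) * sin (t / 2) ^ 2)
      = - 2 * (\<Sum>i=3..n. 1 / ln (real i) * (1 - 1 / ln (real i))) * sin (t / 2) ^ 2"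
    by (simp only: sum_distrib_left sum_distrib_right mult.assoc)
  finally show ?thesis .
qed

text \<open>This is the expectation of the root-of-unity filter at
  \<open>k = walk \<xi> n \<omega>\<close>.\<close>

lemma prob_dvd_walk_fourier:
  assumes "d > 0"
  shows "of_real (prob {\<omega> \<in> space M. d dvd walk \<xi> n \<omega>}) =
    1 / of_nat d * (\<Sum>j<d. expectation (\<lambda>\<omega>. iexp (2 * pi * real j / real d * real (walk \<xi> n \<omega>))))"
proof -
  note [measurable] = walk_measurable[of n]
  have int: "integrable M (\<lambda>\<omega>. iexp (2 * pi * real j / real d * real (walk \<xi> n \<omega>)))" for j
    by (rule integrable_const_bound[where B=1]) auto
  have "(\<Sum>j<d. expectation (\<lambda>\<omega>. iexp (2 * pi * real j / real d * real (walk \<xi> n \<omega>))))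
    = expectation (\<lambda>\<omega>. \<Sum>j<d. iexp (2 * pi * real j / real d * real (walk \<xi> n \<omega>)))"
    using int by (subst Bochner_Integration.integral_sum) auto
  also have "\<dots> = expectation (\<lambda>\<omega>. of_nat d * of_real (indicator {\<omega> \<in> space M. d dvd walk \<xi> n \<omega>} \<omega>))"
    unfolding roots_of_unity_filter[OF assms]
    by (intro Bochner_Integration.integral_cong) (auto split: split_indicator)
  also have "\<dots> = of_nat d * of_real (prob {\<omega> \<in> space M. d dvd walk \<xi> n \<omega>})"
    by simp
  finally show ?thesis using assms by simp
qed

text \<open>Since \<open>t \<le> pi / d\<close>, all half-angles \<open>pi * j / d\<close> with
  \<open>1 \<le> j < d\<close> lie in \<open>[t, pi - t]\<close>, where sine is at least
  \<open>sin t\<close>. The resulting bound is free of \<open>d\<close>: the average over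
  \<open>d - 1\<close> frequencies carries the factor \<open>1 / d\<close>.\<close>

lemma prob_dvd_walk_minus_inverse_le:
  assumes "d \<ge> 1" "0 \<le> t" "t \<le> pi / real d" "t \<le> pi / 2"
  shows "\<bar>prob {\<omega> \<in> space M. d dvd walk \<xi> n \<omega>} - 1 / real d\<bar>
    \<le> exp (- 2 * (\<Sum>i=3..n. 1 / ln (real i) * (1 - 1 / ln (real i))) * sin t ^ 2)" (is "_ \<le> ?R")
proof -
  let ?V = "\<Sum>i=3..n. 1 / ln (real i) * (1 - 1 / ln (real i))"
  let ?\<phi> = "\<lambda>j::nat. expectation (\<lambda>\<omega>. iexp (2 * pi * real j / real d * real (walk \<xi> n \<omega>)))"
  have V: "?V \<ge> 0"
  proof (intro sum_nonneg mult_nonneg_nonneg)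
    fix i assume "i \<in> {3..n}"
    then have i: "i \<ge> 3" by simp
    show "0 \<le> 1 / ln (real i)" using measure_nonneg prob_step_1[OF i] by metis
    show "0 \<le> 1 - 1 / ln (real i)" using measure_nonneg prob_step_0[OF i] by metis
  qed
  have le: "cmod (?\<phi> j) \<le> ?R" if j: "j \<in> {1..<d}" for j
  proof -
    define x where "x = pi * real j / real d"
    have "pi / real d \<le> x" "x \<le> pi * (real d - 1) / real d"
      unfolding x_def using j by (auto intro!: divide_right_mono mult_left_mono)
    moreover have "pi * (real d - 1) / real d = pi - pi / real d"
      using assms by (simp add: field_simps)
    ultimately have "sin t \<le> sin x"
      using assms by (intro sin_le_sin_of_symmetric_interval) auto
    moreover have "0 \<le> sin t" using assms pi_gt_zero by (intro sin_ge_zero) linarith+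
    ultimately have "?V * sin t ^ 2 \<le> ?V * sin x ^ 2"
      using V by (intro mult_left_mono power_mono)
    then have "exp (- 2 * ?V * sin x ^ 2) \<le> ?R" by simp
    moreover have "cmod (?\<phi> j) \<le> exp (- 2 * ?V * sin x ^ 2)"
      using cmod_char_walk_le[of "2 * pi * real j / real d" n] unfolding x_def by simp
    ultimately show ?thesis by linarith
  qed
  \<comment> \<open>The frequency \<open>j = 0\<close> contributes 1 to the sum, which is the source
    of the main term \<open>1 / d\<close>.\<close>
  have "{..<d} = insert 0 {1..<d}" using assms by auto
  then have "(\<Sum>j<d. ?\<phi> j) = 1 + (\<Sum>j=1..<d. ?\<phi> j)"
    by (simp add: prob_space)
  then have eq: "complex_of_real (prob {\<omega> \<in> space M. d dvd walk \<xi> n \<omega>} - 1 / real d) = 1 / of_nat d * (\<Sum>j=1..<d. ?\<phi> j)"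
    using prob_dvd_walk_fourier[of d n] assms by (simp add: algebra_simps add_divide_distrib)
  have "\<bar>prob {\<omega> \<in> space M. d dvd walk \<xi> n \<omega>} - 1 / real d\<bar> =
      cmod (complex_of_real (prob {\<omega> \<in> space M. d dvd walk \<xi> n \<omega>} - 1 / real d))"
    by (rule norm_of_real[symmetric])
  also have "\<dots> = cmod (1 / of_nat d * (\<Sum>j=1..<d. ?\<phi> j))"
    by (simp only: eq)
  also have "\<dots> = 1 / real d * cmod (\<Sum>j=1..<d. ?\<phi> j)"
    by (simp add: norm_mult norm_divide)
  also have "\<dots> \<le> 1 / real d * (\<Sum>j=1..<d. ?R)"
    using le by (intro mult_left_mono sum_norm_le) auto
  also have "\<dots> = (real d - 1) / real d * ?R" using assms by simp
  also have "\<dots> \<le> 1 * ?R" using assms by (intro mult_right_mono) auto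
  finally show ?thesis by simp
qed

lemma walk_var_nonneg: "walk_var M \<xi> n \<ge> 0"
  unfolding walk_var_def by (rule Bochner_Integration.integral_nonneg) simp

end

section \<open>Asymptotics of the cutoff\<close>

text \<open>As \<open>sin x\<close> is asymptotic to \<open>x\<close> at 0, the right-hand side
  behaves like \<open>2 * (n / ln n) * (ln n) ^ 2 * \<alpha> / (2 * n) = \<alpha> * ln n\<close>;
  the strict inequality \<open>\<alpha> > 3 / 2\<close> absorbs the error.\<close>

lemma eventually_variance_times_sin_ge:
  fixes \<alpha> :: real
  assumes "\<alpha> > 3 / 2"
  shows "\<forall>\<^sub>F n::nat in sequentially. 3 / 2 * ln (real n) \<le>
    2 * ((real n - 7) * (1 / ln (real n) * (1 - 1 / ln (real n)))) * sin (ln (real n) * sqrt (\<alpha> / (2 * real n))) ^ 2"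
proof -
  define f where "f n = 2 * ((real n - 7) * (1 / ln (real n) * (1 - 1 / ln (real n))))
    * sin (ln (real n) * sqrt (\<alpha> / (2 * real n))) ^ 2" for n :: nat
  have "\<alpha> > 0" using assms by simp
  then have "(\<lambda>n. f n / ln (real n)) \<longlonglongrightarrow> \<alpha>"
    unfolding f_def by (real_asymp simp: powr_half_sqrt)
  from order_tendstoD(1)[OF this assms] eventually_gt_at_top[of 1]
  show ?thesis
    unfolding f_def[symmetric] by eventually_elim (simp add: field_simps)
qed

text \<open>The powers of \<open>n\<close> cancel, and the expression equals
  \<open>pi ^ 3 * (2 * \<alpha>) powr (3 / 2) * ln n\<close>, which tends to infinity.\<close>

lemma eventually_cutoff_error_ge:
  fixes \<alpha> :: real
  assumes "\<alpha> > 0"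
  shows "\<forall>\<^sub>F n::nat in sequentially.
    1 \<le> (pi / (ln (real n) * sqrt (\<alpha> / (2 * real n)))) ^ 3 * \<alpha> ^ 3 * ln (real n) ^ 4 / real n powr (3 / 2)"
  using assms by real_asymp

lemma eventually_cutoff_le:
  fixes \<alpha> :: real
  assumes "\<alpha> > 0"
  shows "\<forall>\<^sub>F n::nat in sequentially. ln (real n) * sqrt (\<alpha> / (2 * real n)) \<le> 1"
  using assms by real_asymp

section \<open>The two cases of the estimate\<close>

theorem theorem8p1:
  "\<exists>C::real. \<forall>\<alpha>::real. \<alpha> > 3 / 2 \<longrightarrow> (\<exists>n\<^sub>0::nat.
     \<forall>(M :: 'a measure) (\<xi> :: nat \<Rightarrow> 'a \<Rightarrow> nat). cramer_model M \<xi> \<longrightarrow>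
       (\<forall>n d :: nat. n \<ge> n\<^sub>0 \<longrightarrow> d \<ge> 2 \<longrightarrow>
         cmod (complex_of_real (measure M {\<omega> \<in> space M. d dvd walk \<xi> n \<omega>})
               - 1 / of_nat d
               - 1 / of_nat d *
                 (\<Sum>j | 1 \<le> j \<and> real j \<le> real d / pi * ln (real n) * sqrt (\<alpha> / (2 * real n)).
                    exp (2 * \<i> * complex_of_real pi * complex_of_real (walk_mean M \<xi> n)
                            * complex_of_real (real j / real d)
                         - complex_of_real (2 * pi\<^sup>2 * walk_var M \<xi> n * (real j / real d)\<^sup>2))))
         \<le> C * (real d ^ 3 * \<alpha> ^ 3 * ln (real n) ^ 4 / real n powr (3 / 2))))"
\<comment> \<open>The constant 2 comes from the case of a nonempty sum, where
  \<open>\<bar>P - 1 / d\<bar>\<close> and the normalised sum are each at most 1.\<close>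
proof (rule exI[of _ 2], intro allI impI)
  fix \<alpha> :: real
  assume \<alpha>: "\<alpha> > 3 / 2"
  define t where "t n = ln (real n) * sqrt (\<alpha> / (2 * real n))" for n :: nat
  \<comment> \<open>All conditions on \<open>n\<close> involve only \<open>n\<close> and
    \<open>\<alpha>\<close>, so the threshold is uniform in the probability space, the steps and
    \<open>d\<close>.\<close>
  have "\<forall>\<^sub>F n::nat in sequentially. n \<ge> 8 \<and> t n \<le> 1 \<and>
    3 / 2 * ln (real n) \<le> 2 * ((real n - 7) * (1 / ln (real n) * (1 - 1 / ln (real n)))) * sin (t n) ^ 2 \<and>
    1 \<le> (pi / t n) ^ 3 * \<alpha> ^ 3 * ln (real n) ^ 4 / real n powr (3 / 2)"
    unfolding t_def using \<alpha>
    by (intro eventually_conj eventually_ge_at_top eventually_cutoff_le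
        eventually_variance_times_sin_ge eventually_cutoff_error_ge) auto
  then obtain n\<^sub>0 where n0: "\<And>n. n \<ge> n\<^sub>0 \<Longrightarrow> n \<ge> 8 \<and> t n \<le> 1 \<and>
    3 / 2 * ln (real n) \<le> 2 * ((real n - 7) * (1 / ln (real n) * (1 - 1 / ln (real n)))) * sin (t n) ^ 2 \<and>
    1 \<le> (pi / t n) ^ 3 * \<alpha> ^ 3 * ln (real n) ^ 4 / real n powr (3 / 2)"
    unfolding eventually_sequentially by blast
  show "\<exists>n\<^sub>0::nat.
     \<forall>(M :: 'a measure) (\<xi> :: nat \<Rightarrow> 'a \<Rightarrow> nat). cramer_model M \<xi> \<longrightarrow>
       (\<forall>n d :: nat. n \<ge> n\<^sub>0 \<longrightarrow> d \<ge> 2 \<longrightarrow>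
         cmod (complex_of_real (measure M {\<omega> \<in> space M. d dvd walk \<xi> n \<omega>})
               - 1 / of_nat d
               - 1 / of_nat d *
                 (\<Sum>j | 1 \<le> j \<and> real j \<le> real d / pi * ln (real n) * sqrt (\<alpha> / (2 * real n)).
                    exp (2 * \<i> * complex_of_real pi * complex_of_real (walk_mean M \<xi> n)
                            * complex_of_real (real j / real d)
                         - complex_of_real (2 * pi\<^sup>2 * walk_var M \<xi> n * (real j / real d)\<^sup>2))))
         \<le> 2 * (real d ^ 3 * \<alpha> ^ 3 * ln (real n) ^ 4 / real n powr (3 / 2)))"
  proof (intro exI[of _ n\<^sub>0] allI impI)
    fix M :: "'a measure" and \<xi> :: "nat \<Rightarrow> 'a \<Rightarrow> nat" and n d :: nat
    assume "cramer_model M \<xi>" and n: "n \<ge> n\<^sub>0" and d: "d \<ge> 2"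
    then interpret cramer_model M \<xi> by simp
    let ?P = "measure M {\<omega> \<in> space M. d dvd walk \<xi> n \<omega>}"
    let ?J = "{j::nat. 1 \<le> j \<and> real j \<le> real d / pi * ln (real n) * sqrt (\<alpha> / (2 * real n))}"
    let ?e = "\<lambda>j. exp (2 * \<i> * complex_of_real pi * complex_of_real (walk_mean M \<xi> n)
                            * complex_of_real (real j / real d)
                         - complex_of_real (2 * pi\<^sup>2 * walk_var M \<xi> n * (real j / real d)\<^sup>2))"
    let ?E = "real d ^ 3 * \<alpha> ^ 3 * ln (real n) ^ 4 / real n powr (3 / 2)"
    let ?L = "cmod (complex_of_real ?P - 1 / of_nat d - 1 / of_nat d * (\<Sum>j\<in>?J. ?e j))"
    note N = n0[OF n]
    have "exp (1::real) \<le> real n" using e_less_272 N by simp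
    then have ln1: "ln (real n) \<ge> 1" using N by (subst ln_ge_iff) auto
    have t0: "t n > 0" unfolding t_def using ln1 \<alpha> N by simp
    have J: "?J = {j. 1 \<le> j \<and> real j \<le> real d * t n / pi}"
      unfolding t_def by (simp add: mult.assoc)
    show "?L \<le> 2 * ?E"
    proof (cases "t n < pi / real d")
      case False
      have "card ?J \<le> card {1..nat \<lfloor>real d * t n / pi\<rfloor>}"
        unfolding J by (intro card_mono) (auto simp: le_nat_floor)
      also have "real \<dots> \<le> real d * t n / pi"
        using t0 by simp
      finally have card: "real (card ?J) \<le> real d * t n / pi" by simp
      \<comment> \<open>The mean enters only through a phase, and the real part of the exponent is
        nonpositive because the variance is nonnegative.\<close>
      have "cmod (?e j) \<le> 1" for j
        using walk_var_nonneg[of n] by (simp add: norm_exp)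
      then have "cmod (\<Sum>j\<in>?J. ?e j) \<le> (\<Sum>j\<in>?J. 1)"
        by (intro sum_norm_le) auto
      also have "\<dots> \<le> real d * t n / pi" using card by simp
      \<comment> \<open>At most \<open>d\<close> terms occur, which the factor \<open>1 / d\<close>
        in front of the sum compensates.\<close>
      also have "\<dots> \<le> real d"
      proof -
        have "t n \<le> pi" using N pi_gt3 by linarith
        then show ?thesis using d by (simp add: divide_le_eq)
      qed
      finally have "cmod (1 / of_nat d * (\<Sum>j\<in>?J. ?e j)) \<le> 1"
        using d by (simp add: norm_mult norm_divide divide_le_eq)
      moreover have "cmod (complex_of_real ?P - 1 / of_nat d) \<le> 1"
      proof -
        have "complex_of_real ?P - 1 / of_nat d = of_real (?P - 1 / real d)" by simp
        moreover have "\<bar>?P - 1 / real d\<bar> \<le> 1"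
        proof -
          have "0 \<le> 1 / real d" "1 / real d \<le> 1" using d by auto
          moreover have "0 \<le> ?P" "?P \<le> 1" by simp_all
          ultimately show ?thesis by linarith
        qed
        ultimately show ?thesis by (simp only: norm_of_real)
      qed
      ultimately have "?L \<le> 2"
        using norm_triangle_ineq4[of "complex_of_real ?P - 1 / of_nat d" "1 / of_nat d * (\<Sum>j\<in>?J. ?e j)"]
        by linarith
      moreover have "1 \<le> ?E"
      proof -
        \<comment> \<open>The error term increases with \<open>d\<close>, so it suffices to bound it
          below at the smallest possible value \<open>pi / t n\<close>.\<close>
        have "pi / t n \<le> real d" using False t0 d by (simp add: field_simps)
        then have "(pi / t n) ^ 3 \<le> real d ^ 3" using t0 by (intro power_mono) auto
        then have "(pi / t n) ^ 3 * \<alpha> ^ 3 * ln (real n) ^ 4 / real n powr (3 / 2) \<le> ?E"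
          using \<alpha> by (intro divide_right_mono mult_right_mono) auto
        then show ?thesis using N by linarith
      qed
      ultimately show ?thesis by linarith
    next
      case True
      let ?V = "\<Sum>i=3..n. 1 / ln (real i) * (1 - 1 / ln (real i))"
      have "real d * t n / pi < 1" using True d by (simp add: field_simps)
      then have "\<not> (1 \<le> j \<and> real j \<le> real d * t n / pi)" for j :: nat
        using of_nat_mono[of 1 j, where 'a = real] by linarith
      then have "?J = {}" unfolding J by blast
      then have "?L = cmod (of_real (?P - 1 / real d))"
        by (simp only: sum.empty) simp
      also have "\<dots> = \<bar>?P - 1 / real d\<bar>" by (rule norm_of_real)
      also have "\<dots> \<le> exp (- 2 * ?V * sin (t n) ^ 2)"
      proof (rule prob_dvd_walk_minus_inverse_le)
        show "t n \<le> pi / 2" using N pi_gt3 by linarith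
      qed (use True t0 d in auto)
      also have "\<dots> \<le> exp (- (3 / 2 * ln (real n)))"
      proof -
        \<comment> \<open>The variance sum is replaced by its explicit lower bound, for which
          \<open>n\<^sub>0\<close> was chosen.\<close>
        have "(real n - 7) * (1 / ln (real n) * (1 - 1 / ln (real n))) * sin (t n) ^ 2 \<le> ?V * sin (t n) ^ 2"
          using N by (intro mult_right_mono sum_bernoulli_variances_ge) auto
        then show ?thesis using N by simp
      qed
      also have "\<dots> = 1 / real n powr (3 / 2)"
        using N by (simp add: powr_def exp_minus field_simps)
      also have "\<dots> \<le> ?E"
      proof -
        \<comment> \<open>Each factor is at least 1, so the decay \<open>n powr - (3 / 2)\<close>
          alone already stays within the error term.\<close>
        have "1 \<le> real d ^ 3 * \<alpha> ^ 3 * ln (real n) ^ 4"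
          using d \<alpha> ln1 by (intro mult_ge1_I one_le_power) auto
        then show ?thesis by (intro divide_right_mono) auto
      qed
      also have "\<dots> \<le> 2 * ?E"
      proof -
        have "0 \<le> ?E" using \<alpha> ln1 by (intro divide_nonneg_nonneg mult_nonneg_nonneg) auto
        then show ?thesis by linarith
      qed
      finally show ?thesis .
    qed
  qed
qed

end
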